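(* $$\int_0^1 \ln(-\ln x)\,\frac{1}{1-x+x^2}\,dx = \frac{2\pi}{\sqrt3}\left[\frac56\ln(2\pi)-\ln\Gamma\left(\frac16\right)\right].$$
   Context: $\Gamma$ denotes the gamma function. *)

theory Defs
  imports "HOL-Analysis.Analysis"
begin

end

theory Submission
  imports Defs
begin

text \<open>
  The substitution \<open>x = exp (- 2 \<pi> t)\<close> turns the integral into one of \<open>ln (2 \<pi> t)\<close> against a multiple
  of \<open>\<pi> sin (2 \<pi> p) / (cosh (2 \<pi> t) - cos (2 \<pi> p))\<close> on the positive half-line, with \<open>p = 1/6\<close>. This kernel is
  the real part of \<open>\<pi> cot (\<pi> (p + i t))\<close>, so with \<open>f b = b / (b\<^sup>2 + t\<^sup>2)\<close> the partial fraction
  expansion of the cotangent writes it as the sum over \<open>k \<ge> 0\<close> of \<open>f (k + p) - f (k + 1 - p)\<close>. Since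
  \<open>ln (c t)\<close> integrates against \<open>f b\<close> to \<open>\<pi>/2 ln (c b)\<close>, integrating the partial sums gives the
  logarithm of the product that defines \<open>\<Gamma> (1 - p) / \<Gamma> (p)\<close>.

  The sum of the termwise integrals diverges like the harmonic series, so sum and integral cannot be
  interchanged as they stand. Adding \<open>(1 - 2 p) f n\<close> to the \<open>n\<close>-th partial sum does not change the
  pointwise limit, supplies exactly the normalisation \<open>(1 - 2 p) ln n\<close> of the product, and
  makes the sequence dominated by a multiple of \<open>1 / (1 + t\<^sup>2)\<close>. The reflection formula eliminates
  \<open>\<Gamma> (5/6)\<close>.
\<close>

section \<open>Reflection formula and partial fractions of the cotangent\<close>

lemma Gamma_reflection_real:
  "Gamma x * Gamma (1 - x) = pi / sin (pi * x)" for x :: real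
proof -
  have "complex_of_real (1 - x) = 1 - of_real x"
    by simp
  hence "complex_of_real (Gamma x * Gamma (1 - x)) = of_real (pi / sin (pi * x))"
    using Gamma_reflection_complex[of "of_real x"]
    by (metis Gamma_complex_of_real of_real_divide of_real_mult sin_of_real)
  thus ?thesis
    by (simp only: of_real_eq_iff)
qed

text \<open>Logarithmic derivative of the reflection formula: on the strip
  \<open>Gamma w * Gamma (1 - w) * sin (pi * w)\<close> is the constant \<open>pi\<close>, so its
  derivative vanishes. This expresses the cotangent as a difference of two \<open>Digamma\<close>
  values.\<close>

lemma pi_cot_partial_fractions:
  fixes z :: complex
  assumes "0 < Re z" "Re z < 1"
  shows "(\<lambda>n. \<Sum>k<n. inverse (z + of_nat k) - inverse (1 - z + of_nat k))
           \<longlonglongrightarrow> of_real pi * cot (of_real pi * z)"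
proof -
  have not_Ints: "w \<notin> \<int>" if "0 < Re w" "Re w < 1" for w :: complex
    using that by (auto elim!: Ints_cases)
  have nz: "w \<notin> \<int>\<^sub>\<le>\<^sub>0" if "0 < Re w" for w :: complex
    using that by (auto elim!: nonpos_Ints_cases)
  have sin_nz: "sin (of_real pi * w) \<noteq> 0" if "0 < Re w" "Re w < 1" for w :: complex
    using not_Ints[OF that] by (auto simp: sin_eq_0 Ints_def)
  let ?P = "\<lambda>w::complex. Gamma w * Gamma (1 - w) * sin (of_real pi * w)"
  let ?D = "?P z * (Digamma z - Digamma (1 - z) + of_real pi * cot (of_real pi * z))"
  have "(?P has_field_derivative ?D) (at z)"
    using nz[of z] nz[of "1 - z"] sin_nz[OF assms] assms
    by (auto intro!: derivative_eq_intros simp: cot_def field_simps)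
  moreover have "eventually (\<lambda>w. w \<in> {w. 0 < Re w} \<inter> {w. Re w < 1}) (nhds z)"
    by (rule eventually_nhds_in_open)
       (use assms in \<open>auto intro!: open_Int open_halfspace_Re_gt open_halfspace_Re_lt\<close>)
  hence "eventually (\<lambda>w. ?P w = of_real pi) (nhds z)"
    by eventually_elim (use sin_nz in \<open>auto simp: Gamma_reflection_complex\<close>)
  ultimately have "((\<lambda>_. of_real pi) has_field_derivative ?D) (at z)"
    by (subst (asm) DERIV_cong_ev[OF refl _ refl]) auto
  hence "?D = 0"
    using DERIV_const DERIV_unique by blast
  hence eq: "Digamma (1 - z) - Digamma z = of_real pi * cot (of_real pi * z)"
    using sin_nz[OF assms] by (simp add: Gamma_reflection_complex)
       (simp add: algebra_simps eq_neg_iff_add_eq_0)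
  \<comment> \<open>The divergent \<open>ln m\<close> of the two \<open>Digamma\<close> limits
    cancels, leaving the partial sums.\<close>
  have "(\<lambda>m. (of_real (ln (real m)) - (\<Sum>n<m. inverse ((1 - z) + of_nat n))) -
             (of_real (ln (real m)) - (\<Sum>n<m. inverse (z + of_nat n))))
        \<longlonglongrightarrow> Digamma (1 - z) - Digamma z"
    by (intro tendsto_diff Digamma_LIMSEQ) (use assms in auto)
  thus ?thesis
    by (simp add: eq sum_subtractf)
qed

text \<open>Multiply numerator and denominator by the conjugate of the sine. At a pole both sides
  are 0 by the convention \<open>x / 0 = 0\<close>.\<close>

lemma Re_cot:
  "Re (cot (Complex x y)) = sin (2 * x) / (cosh (2 * y) - cos (2 * x))"
proof -
  have "sin x * cosh y * (cos x * cosh y) - sin x * sinh y * (cos x * sinh y)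
          = sin x * cos x * (cosh y ^ 2 - sinh y ^ 2)"
    by (simp add: algebra_simps power2_eq_square)
  also have "\<dots> = sin (2 * x) / 2"
    by (simp add: hyperbolic_pythagoras sin_double)
  finally have num: "sin x * cosh y * (cos x * cosh y) - sin x * sinh y * (cos x * sinh y) = sin (2 * x) / 2" .
  have "(sin x * cosh y)\<^sup>2 + (cos x * sinh y)\<^sup>2
          = (sin x)\<^sup>2 * ((sinh y)\<^sup>2 + 1) + (cos x)\<^sup>2 * (sinh y)\<^sup>2"
    by (simp add: power_mult_distrib cosh_square_eq)
  also have "\<dots> = (sin x)\<^sup>2 + (sinh y)\<^sup>2 * ((sin x)\<^sup>2 + (cos x)\<^sup>2)"
    by (simp add: algebra_simps del: sin_cos_squared_add sin_cos_squared_add2)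
  also have "\<dots> = (cosh (2 * y) - cos (2 * x)) / 2"
    by (simp add: cosh_double cosh_square_eq cos_double_sin)
  finally have den: "(sin x * cosh y)\<^sup>2 + (cos x * sinh y)\<^sup>2 = (cosh (2 * y) - cos (2 * x)) / 2" .
  have "sin (Complex x y) = Complex (sin x * cosh y) (cos x * sinh y)"
       "cos (Complex x y) = Complex (cos x * cosh y) (- sin x * sinh y)"
    by (simp_all add: complex_eq_iff Re_sin Im_sin Re_cos Im_cos cosh_def sinh_def algebra_simps
      add_divide_distrib diff_divide_distrib)
  thus ?thesis
    unfolding cot_def Re_divide using num
    by (simp add: den) (simp add: mult_ac)
qed

section \<open>Integrals of the logarithm against rational kernels\<close>

text \<open>Both bounds come from \<open>ln v \<le> v - 1\<close> at the square root of
  \<open>t\<close> or of its inverse. They give integrable majorants at 0 and at infinity.\<close>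

lemma abs_ln_le_powr:
  fixes t :: real
  assumes "t > 0"
  shows "t \<le> 1 \<Longrightarrow> \<bar>ln t\<bar> \<le> 2 * t powr (-1/2)"
    and "t \<ge> 1 \<Longrightarrow> \<bar>ln t\<bar> \<le> 2 * t powr (1/2)"
proof -
  have *: "ln u \<le> 2 * u powr (1/2)" if "u > 0" for u :: real
    using ln_le_minus_one[of "u powr (1/2)"] that by (simp add: ln_powr)
  show "t \<ge> 1 \<Longrightarrow> \<bar>ln t\<bar> \<le> 2 * t powr (1/2)" using *[of t] assms by simp
  show "t \<le> 1 \<Longrightarrow> \<bar>ln t\<bar> \<le> 2 * t powr (-1/2)" using *[of "inverse t"] assms
    by (simp add: ln_inverse powr_minus inverse_powr)
qed

lemma absolutely_integrable_ln_over_one_plus_square: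
  "(\<lambda>t::real. ln t / (1 + t\<^sup>2)) absolutely_integrable_on {0<..}"
proof -
  have meas: "(\<lambda>t::real. ln t / (1 + t\<^sup>2)) \<in> borel_measurable (lebesgue_on S)" for S
    by (intro measurable_restrict_space1 measurable_completion) measurable
  have "(\<lambda>t::real. ln t / (1 + t\<^sup>2)) absolutely_integrable_on {0<..1}"
  proof (rule measurable_bounded_by_integrable_imp_absolutely_integrable)
    have "(\<lambda>t::real. 2 * t powr (-1/2)) integrable_on {0..1}"
      by (rule has_integral_integrable[OF has_integral_mult_right[OF has_integral_powr_from_0]]) auto
    thus "(\<lambda>t::real. 2 * t powr (-1/2)) integrable_on {0<..1}"
      by (rule integrable_spike_set) (auto intro!: negligible_subset[OF negligible_sing[of 0]])
  next
    fix t :: real assume "t \<in> {0<..1}"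
    hence "\<bar>ln t\<bar> / (1 + t\<^sup>2) \<le> 2 * t powr (-1/2) / 1"
      by (intro frac_le abs_ln_le_powr) auto
    thus "norm (ln t / (1 + t\<^sup>2)) \<le> 2 * t powr (-1/2)" by (simp add: abs_mult)
  qed (auto intro!: meas)
  moreover have "(\<lambda>t::real. ln t / (1 + t\<^sup>2)) absolutely_integrable_on {1..}"
  proof (rule measurable_bounded_by_integrable_imp_absolutely_integrable)
    show "(\<lambda>t::real. 2 * t powr (-3/2)) integrable_on {1..}"
      by (rule has_integral_integrable[OF has_integral_mult_right[OF has_integral_powr_to_inf]]) auto
  next
    fix t :: real assume t: "t \<in> {1..}"
    hence "\<bar>ln t\<bar> / (1 + t\<^sup>2) \<le> 2 * t powr (1/2) / t powr 2"
      by (intro frac_le abs_ln_le_powr) auto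
    also have "\<dots> = 2 * t powr (-3/2)"
      using t powr_diff[of t "1/2" 2] by simp
    finally show "norm (ln t / (1 + t\<^sup>2)) \<le> 2 * t powr (-3/2)" by (simp add: abs_mult)
  qed (auto intro!: meas)
  ultimately have "(\<lambda>t::real. ln t / (1 + t\<^sup>2)) absolutely_integrable_on {0<..1} \<union> {1..}"
    by (rule set_integrable_Un) auto
  also have "{0<..1} \<union> {1..} = {0::real<..}" by auto
  finally show ?thesis .
qed

text \<open>The inversion of \<open>t\<close> preserves the measure
  \<open>dt / (1 + t\<^sup>2)\<close> and changes the sign of the logarithm, so the integral equals
  its own negative.\<close>

lemma integral_ln_over_one_plus_square:
  "integral {0<..} (\<lambda>t::real. ln t / (1 + t\<^sup>2)) = 0"
proof -
  define f where "f = (\<lambda>t::real. ln t / (1 + t\<^sup>2))"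
  have img: "inverse ` {0<..} = {0::real<..}"
    by (force simp: image_iff intro: bexI[of _ "inverse _"])
  have cong: "\<bar>- (inverse t ^ 2)\<bar> * f (inverse t) = - f t" if "t \<in> {0<..}" for t
    using that by (simp add: f_def ln_div field_simps)
  have "integral {0<..} f = integral {0<..} (\<lambda>t. \<bar>- (inverse t ^ 2)\<bar> * f (inverse t))"
  proof -
    have "(inverse has_field_derivative - (inverse t ^ 2)) (at t within {0<..})" if "t \<in> {0<..}" for t :: real
      using that by (auto intro!: derivative_eq_intros simp: power2_eq_square)
    thus ?thesis
      using has_absolute_integral_change_of_variables_1'
        [of "{0<..}" "inverse" "\<lambda>t. - (inverse t ^ 2)" f "integral {0<..} f"]
        absolutely_integrable_ln_over_one_plus_square
      unfolding img f_def[symmetric] by (simp add: inj_on_def)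
  qed
  also have "\<dots> = - integral {0<..} f"
    by (subst integral_neg [symmetric], rule integral_cong) (use cong in auto)
  finally show ?thesis by (simp add: f_def)
qed

lemma has_integral_one_over_one_plus_square:
  "((\<lambda>t::real. 1 / (1 + t\<^sup>2)) has_integral pi / 2) {0<..}"
proof -
  have FTC: "((\<lambda>t::real. 1 / (1 + t\<^sup>2)) has_integral arctan y) {0..y}" if "y \<ge> 0" for y
  proof -
    have "((\<lambda>t::real. 1 / (1 + t\<^sup>2)) has_integral (arctan y - arctan 0)) {0..y}"
      using that
      by (intro fundamental_theorem_of_calculus)
         (auto intro!: derivative_eq_intros simp: divide_inverse
             simp flip: has_real_derivative_iff_has_vector_derivative)
    thus ?thesis by simp
  qed
  have "((\<lambda>t::real. 1 / (1 + t\<^sup>2)) has_integral pi / 2) {0..}"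
  proof (rule has_integral_to_inf)
    fix y :: real
    show "(\<lambda>t::real. 1 / (1 + t\<^sup>2)) integrable_on {0..y}"
      by (cases "y \<ge> 0") (use FTC in \<open>auto simp: integrable_on_def\<close>)
  next
    have "eventually (\<lambda>y. integral {0..y} (\<lambda>t::real. 1 / (1 + t\<^sup>2)) = arctan y) at_top"
      using eventually_ge_at_top[of 0] by eventually_elim (use FTC in blast)
    thus "((\<lambda>y. integral {0..y} (\<lambda>t::real. 1 / (1 + t\<^sup>2))) \<longlongrightarrow> pi / 2) at_top"
      using tendsto_arctan_at_top by (simp add: filterlim_cong)
  qed auto
  thus ?thesis
    by (subst has_integral_spike_set_eq[where T = "{0..}"])
       (auto intro!: negligible_subset[OF negligible_sing[of 0]])
qed

lemma absolutely_integrable_ln_poisson_kernel: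
  fixes b c :: real
  assumes "b > 0" "c > 0"
  shows "(\<lambda>t. ln (c * t) * (b / (b\<^sup>2 + t\<^sup>2))) absolutely_integrable_on {0<..}" (is ?thesis1)
    and "integral {0<..} (\<lambda>t. ln (c * t) * (b / (b\<^sup>2 + t\<^sup>2))) = pi / 2 * ln (c * b)" (is ?thesis2)
proof -
  \<comment> \<open>The integrand after \<open>t = b * u\<close>, with \<open>ln (c * b * u)\<close>
    split: the first summand integrates to 0, the second to an arctangent integral.\<close>
  define f where "f = (\<lambda>u::real. ln u / (1 + u\<^sup>2) + ln (c * b) * (1 / (1 + u\<^sup>2)))"
  have abs1: "(\<lambda>u::real. 1 / (1 + u\<^sup>2)) absolutely_integrable_on {0<..}"
    using has_integral_one_over_one_plus_square
    by (intro nonnegative_absolutely_integrable_1) (auto simp: integrable_on_def)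
  have f: "f absolutely_integrable_on {0<..}"
    unfolding f_def
    by (intro set_integral_add absolutely_integrable_ln_over_one_plus_square
          set_integrable_mult_right abs1)
  have "integral {0<..} f = 0 + ln (c * b) * (pi / 2)"
    unfolding f_def
    using absolutely_integrable_ln_over_one_plus_square[THEN set_lebesgue_integral_eq_integral(1)]
      has_integral_one_over_one_plus_square
    by (intro integral_unique has_integral_add has_integral_mult_right)
       (auto simp: integral_ln_over_one_plus_square dest: integrable_integral)
  moreover have "(\<lambda>t. t / b) ` {0<..} = {0<..}"
  proof
    show "{0<..} \<subseteq> (\<lambda>t. t / b) ` {0<..}"
      using assms by (auto simp: image_iff intro!: bexI[of _ "_ * b"])
  qed (use assms in auto)
  ultimately have "(\<lambda>t. \<bar>1 / b\<bar> * f (t / b)) absolutely_integrable_on {0<..} \<and>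
     integral {0<..} (\<lambda>t. \<bar>1 / b\<bar> * f (t / b)) = pi / 2 * ln (c * b)"
    using f assms
    by (subst has_absolute_integral_change_of_variables_1')
       (auto intro!: derivative_eq_intros simp: inj_on_def)
  moreover have "\<bar>1 / b\<bar> * f (t / b) = ln (c * t) * (b / (b\<^sup>2 + t\<^sup>2))" if "t \<in> {0<..}" for t
  proof -
    have "f (t / b) = ln (c * t) / (1 + (t / b)\<^sup>2)"
      using that assms unfolding f_def
      by (simp add: ln_mult ln_div add_divide_distrib diff_divide_distrib)
    also have "1 + (t / b)\<^sup>2 = (b\<^sup>2 + t\<^sup>2) / b\<^sup>2"
      using assms by (simp add: field_simps)
    finally show ?thesis
      using assms by (simp add: power2_eq_square)
  qed
  ultimately show ?thesis1 ?thesis2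
    using set_integrable_cong[of lebesgue lebesgue "{0<..}" "{0<..}" "\<lambda>t. \<bar>1 / b\<bar> * f (t / b)"
            "\<lambda>t. ln (c * t) * (b / (b\<^sup>2 + t\<^sup>2))"]
          integral_cong[of "{0<..}" "\<lambda>t. \<bar>1 / b\<bar> * f (t / b)"
            "\<lambda>t. ln (c * t) * (b / (b\<^sup>2 + t\<^sup>2))"]
    by (simp_all only:)
qed

section \<open>Increments of the corrected partial sums and the Gamma quotient\<close>

text \<open>Controls the step from one corrected partial sum to the next: the bound is summable in
  \<open>k\<close>, with a single integrable profile in \<open>t\<close>.\<close>

lemma poisson_kernel_difference_bound:
  fixes p t :: real and k :: nat
  assumes "0 < p" "p < 1" "k > 0"
  defines "f \<equiv> \<lambda>b. b / (b\<^sup>2 + t\<^sup>2)"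
  shows "\<bar>f (real k + p) - f (real k + 1 - p) - (1 - 2 * p) * (f (real k) - f (real k + 1))\<bar>
           \<le> 1 / (real k)\<^sup>2 / (1 + t\<^sup>2)"
proof -
  \<comment> \<open>As \<open>(z + p) (z + 1 - p) = z (z + 1) + p (1 - p)\<close>, the main terms cancel and leave a fourth-order quotient.\<close>
  define z where "z = Complex (real k) t"
  define P :: complex where "P = of_real p"
  have f: "f b = Re (inverse (Complex b t))" for b
    by (simp add: f_def)
  have nz: "z \<noteq> 0" "z + 1 \<noteq> 0" "z + P \<noteq> 0" "z + 1 - P \<noteq> 0"
    using assms by (auto simp: z_def P_def complex_eq_iff)
  have norm_ge: "norm z \<le> norm (z + of_real x)" if "x \<ge> 0" for x
    using that by (auto simp: z_def cmod_def intro!: power_mono)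
  have "f (real k + p) - f (real k + 1 - p) - (1 - 2 * p) * (f (real k) - f (real k + 1)) =
        Re (inverse (z + P) - inverse (z + 1 - P) - (1 - 2 * P) * (inverse z - inverse (z + 1)))"
  proof -
    have "Complex (real k + p) t = z + P" "Complex (real k + 1 - p) t = z + 1 - P" "Complex k t = z"
      "Complex (real k + 1) t = z + 1" "1 - 2 * P = of_real (1 - 2 * p)"
      by (auto simp: z_def P_def complex_eq_iff)
    thus ?thesis
      unfolding f
      by (simp only: minus_complex.sel Re_complex_of_real times_complex.sel Im_complex_of_real
            mult_zero_left diff_zero)
  qed
  also have "inverse (z + P) - inverse (z + 1 - P) - (1 - 2 * P) * (inverse z - inverse (z + 1)) =
     - ((1 - 2 * P) * P * (1 - P)) / (z * (z + 1) * (z + P) * (z + 1 - P))"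
    using nz by (simp add: divide_simps) (simp add: algebra_simps)
  finally have "\<bar>f (real k + p) - f (real k + 1 - p) - (1 - 2 * p) * (f (real k) - f (real k + 1))\<bar> \<le>
     norm (- ((1 - 2 * P) * P * (1 - P)) / (z * (z + 1) * (z + P) * (z + 1 - P)))"
    using abs_Re_le_cmod by metis
  also have "\<dots> = \<bar>1 - 2 * p\<bar> * p * (1 - p) / (norm z * norm (z + 1) * norm (z + P) * norm (z + 1 - P))"
  proof -
    have "1 - 2 * P = of_real (1 - 2 * p)" "1 - P = of_real (1 - p)"
      by (simp_all add: P_def)
    hence "norm (1 - 2 * P) = \<bar>1 - 2 * p\<bar>" "norm (1 - P) = 1 - p" "norm P = p"
      using assms by (simp_all only: norm_of_real P_def)
    thus ?thesis
      by (simp add: norm_divide norm_mult)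
  qed
  \<comment> \<open>As \<open>Re z\<close> is nonnegative, shifting \<open>z\<close> to the right by
    1, \<open>p\<close> or \<open>1 - p\<close> cannot decrease its norm.\<close>
  also have "\<dots> \<le> (1 * 1 * 1) / (norm z * norm z * norm z * norm z)"
    using nz norm_ge[of 1] norm_ge[of p] norm_ge[of "1 - p"] assms
    by (intro frac_le mult_mono) (auto simp: P_def add_diff_eq)
  also have "norm z * norm z * norm z * norm z = ((real k)\<^sup>2 + t\<^sup>2) * ((real k)\<^sup>2 + t\<^sup>2)"
  proof -
    have "norm z * norm z = (real k)\<^sup>2 + t\<^sup>2"
      by (simp add: z_def cmod_def)
    thus ?thesis
      by (simp only: mult.assoc)
  qed
  \<comment> \<open>One factor is bounded below by \<open>k\<^sup>2\<close>, the other by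
    \<open>1 + t\<^sup>2\<close> because \<open>k \<ge> 1\<close>.\<close>
  also have "(1 * 1 * 1) / (((real k)\<^sup>2 + t\<^sup>2) * ((real k)\<^sup>2 + t\<^sup>2)) \<le> (1 * 1 * 1) / ((real k)\<^sup>2 * (1 + t\<^sup>2))"
    using assms by (intro divide_left_mono mult_mono) (auto intro!: mult_pos_pos add_pos_nonneg)
  finally show ?thesis by simp
qed

text \<open>In the quotient of the Gauss products for \<open>1 - p\<close> and \<open>p\<close> the
  factorials cancel, and the powers of \<open>Suc n\<close> leave the exponent
  \<open>1 - 2 * p\<close>.\<close>

lemma ln_Gamma_quotient_LIMSEQ:
  fixes p :: real
  assumes "0 < p" "p < 1"
  shows "(\<lambda>n. (\<Sum>k<Suc n. ln (real k + p) - ln (real k + 1 - p)) + (1 - 2 * p) * ln (real (Suc n)))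
           \<longlonglongrightarrow> ln (Gamma (1 - p)) - ln (Gamma p)"
proof -
  have ln_series: "ln (Gamma_series' x (Suc n)) =
                     ln (fact n) + x * ln (real (Suc n)) - (\<Sum>k<Suc n. ln (real k + x))"
    if "x > 0" for x :: real and n
  proof -
    have "pochhammer x (Suc n) > 0"
      using that by (rule pochhammer_pos)
    moreover have "ln (pochhammer x (Suc n)) = (\<Sum>k<Suc n. ln (real k + x))"
      unfolding pochhammer_prod using that
      by (subst ln_prod) (auto simp: atLeast0LessThan add_ac intro: add_nonneg_pos less_imp_neq[symmetric])
    ultimately show ?thesis
      unfolding Gamma_series'_def by (simp add: ln_div ln_mult)
  qed
  have "(\<lambda>n. ln (Gamma_series' x (Suc n))) \<longlonglongrightarrow> ln (Gamma x)" if "x > 0" for x :: real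
    using that by (intro tendsto_ln filterlim_compose[OF Gamma_series'_LIMSEQ filterlim_Suc])
       (auto simp: Gamma_eq_zero_iff elim!: nonpos_Ints_cases)
  hence "(\<lambda>n. ln (Gamma_series' (1 - p) (Suc n)) - ln (Gamma_series' p (Suc n)))
           \<longlonglongrightarrow> ln (Gamma (1 - p)) - ln (Gamma p)"
    using assms by (intro tendsto_diff) auto
  also have "(\<lambda>n. ln (Gamma_series' (1 - p) (Suc n)) - ln (Gamma_series' p (Suc n))) =
             (\<lambda>n. (\<Sum>k<Suc n. ln (real k + p) - ln (real k + 1 - p)) + (1 - 2 * p) * ln (real (Suc n)))"
    using assms unfolding sum_subtractf
    by (intro ext) (simp only: ln_series diff_gt_0_iff_gt, simp add: algebra_simps)
  finally show ?thesis .
qed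

section \<open>Dominated convergence for the hyperbolic kernel\<close>

lemma absolutely_integrable_ln_cosh_kernel:
  fixes p c :: real
  assumes p: "0 < p" "p < 1" and c: "c > 0"
  defines "g \<equiv> \<lambda>t. ln (c * t) * (pi * sin (2 * pi * p) / (cosh (2 * pi * t) - cos (2 * pi * p)))"
  shows "g absolutely_integrable_on {0<..}"
    and "integral {0<..} g = pi / 2 * (ln (Gamma (1 - p)) - ln (Gamma p) + (1 - 2 * p) * ln c)"
proof -
  define f where "f = (\<lambda>t b::real. b / (b\<^sup>2 + t\<^sup>2))"
  \<comment> \<open>The correction sits at \<open>Suc n\<close>, the number of summands, so it is
    defined away from the singular index 0 and each increment has an index
    \<open>k > 0\<close>.\<close>
  define S where "S = (\<lambda>n t. (\<Sum>k<Suc n. f t (real k + p) - f t (real k + 1 - p)) +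
                             (1 - 2 * p) * f t (real (Suc n)))"
  \<comment> \<open>The first three terms bound the three kernels in \<open>S 0 t\<close>; the
    series bounds the sum of all later increments.\<close>
  define B where "B = 1 / p + 1 / (1 - p) + 1 + (\<Sum>k. 1 / (real (Suc k))\<^sup>2)"
  define h where "h = (\<lambda>t. B * \<bar>ln (c * t) * (1 / (1\<^sup>2 + t\<^sup>2))\<bar>)"

  have S_lim: "(\<lambda>n. S n t) \<longlonglongrightarrow> pi * sin (2 * pi * p) / (cosh (2 * pi * t) - cos (2 * pi * p))" for t
  proof -
    have "(\<lambda>n. Re (\<Sum>k<n. inverse (Complex p t + of_nat k) - inverse (1 - Complex p t + of_nat k)))
            \<longlonglongrightarrow> Re (of_real pi * cot (of_real pi * Complex p t))"
      using p by (intro tendsto_Re pi_cot_partial_fractions) auto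
    also have "Re (of_real pi * cot (of_real pi * Complex p t)) =
                 pi * sin (2 * pi * p) / (cosh (2 * pi * t) - cos (2 * pi * p))"
      by (simp add: complex_of_real_mult_Complex Re_cot mult_ac)
    also have "(\<lambda>n. Re (\<Sum>k<n. inverse (Complex p t + of_nat k) - inverse (1 - Complex p t + of_nat k))) =
                 (\<lambda>n. \<Sum>k<n. f t (real k + p) - f t (real k + 1 - p))"
      by (simp add: f_def algebra_simps)
    finally have "(\<lambda>n. \<Sum>k<Suc n. f t (real k + p) - f t (real k + 1 - p))
                    \<longlonglongrightarrow> pi * sin (2 * pi * p) / (cosh (2 * pi * t) - cos (2 * pi * p))"
      by (rule filterlim_compose[OF _ filterlim_Suc])
    moreover have "(\<lambda>n. f t (real (Suc n))) \<longlonglongrightarrow> 0"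
      unfolding f_def by real_asymp
    ultimately show ?thesis
      unfolding S_def
      by (auto intro!: tendsto_eq_intros simp del: sum.lessThan_Suc simp flip: of_nat_Suc)
  qed

  have S_bound: "\<bar>S n t\<bar> \<le> B / (1 + t\<^sup>2)" for n t
  proof -
    have f_le: "\<bar>f t b\<bar> \<le> 1 / b / (1 + t\<^sup>2)" if "0 < b" "b \<le> 1" for b
    proof -
      have "b\<^sup>2 * t\<^sup>2 \<le> 1 * t\<^sup>2"
        using that by (intro mult_right_mono) (auto simp: power_le_one)
      hence "b * (b * (1 + t\<^sup>2)) \<le> 1 * (b\<^sup>2 + t\<^sup>2)"
        by (simp add: algebra_simps power2_eq_square)
      thus ?thesis
        using that by (simp add: f_def divide_simps add_pos_nonneg mult_ac)
    qed
    have "\<bar>S n t\<bar> \<le> (1 / p + 1 / (1 - p) + 1 + (\<Sum>k<n. 1 / (real (Suc k))\<^sup>2)) / (1 + t\<^sup>2)"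
    proof (induction n)
      case 0
      have "\<bar>(1 - 2 * p) * f t 1\<bar> \<le> 1 * (1 / 1 / (1 + t\<^sup>2))"
        unfolding abs_mult using p by (intro mult_mono f_le) auto
      moreover have "\<bar>f t p\<bar> \<le> 1 / p / (1 + t\<^sup>2)" "\<bar>f t (1 - p)\<bar> \<le> 1 / (1 - p) / (1 + t\<^sup>2)"
        using p by (intro f_le; simp)+
      moreover have "S 0 t = f t p - f t (1 - p) + (1 - 2 * p) * f t 1"
        by (simp add: S_def)
      ultimately show ?case
        unfolding add_divide_distrib by simp
    next
      case (Suc n)
      \<comment> \<open>Replacing the old correction by the new one contributes exactly the
        subtracted difference in the increment bound.\<close>
      have "S (Suc n) t = S n t + (f t (real (Suc n) + p) - f t (real (Suc n) + 1 - p)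
              - (1 - 2 * p) * (f t (real (Suc n)) - f t (real (Suc n) + 1)))"
        by (simp add: S_def algebra_simps)
      moreover have "\<bar>f t (real (Suc n) + p) - f t (real (Suc n) + 1 - p)
              - (1 - 2 * p) * (f t (real (Suc n)) - f t (real (Suc n) + 1))\<bar>
              \<le> 1 / (real (Suc n))\<^sup>2 / (1 + t\<^sup>2)"
        unfolding f_def using p by (intro poisson_kernel_difference_bound) auto
      ultimately show ?case
        using Suc.IH unfolding sum.lessThan_Suc add_divide_distrib by linarith
    qed
    also have "\<dots> \<le> B / (1 + t\<^sup>2)"
      unfolding B_def using inverse_squares_sums
      by (intro divide_right_mono add_left_mono sum_le_suminf) (auto simp: sums_iff add_ac)
    finally show ?thesis .
  qed

  have kernel: "((\<lambda>t. ln (c * t) * f t b) has_integral (pi / 2 * ln (c * b))) {0<..}" if "b > 0" for b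
    using absolutely_integrable_ln_poisson_kernel[OF that c] set_lebesgue_integral_eq_integral(1)
    unfolding f_def by (metis integrable_integral)

  have ln_c: "ln (c * b) = ln c + ln b" if "b > 0" for b
    using that c by (rule ln_mult_pos[rotated])
  have int_S: "((\<lambda>t. ln (c * t) * S n t) has_integral
     pi / 2 * (((\<Sum>k<Suc n. ln (real k + p) - ln (real k + 1 - p)) + (1 - 2 * p) * ln (real (Suc n)))
               + (1 - 2 * p) * ln c)) {0<..}" for n
  proof -
    have "((\<lambda>t. (\<Sum>k<Suc n. ln (c * t) * f t (real k + p) - ln (c * t) * f t (real k + 1 - p)) +
                 (1 - 2 * p) * (ln (c * t) * f t (real (Suc n)))) has_integral
          ((\<Sum>k<Suc n. pi / 2 * ln (c * (real k + p)) - pi / 2 * ln (c * (real k + 1 - p))) +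
            (1 - 2 * p) * (pi / 2 * ln (c * real (Suc n))))) {0<..}"
      using p by (intro has_integral_add has_integral_sum has_integral_diff has_integral_mult_right kernel) auto
    also have "(\<lambda>t. (\<Sum>k<Suc n. ln (c * t) * f t (real k + p) - ln (c * t) * f t (real k + 1 - p)) +
                 (1 - 2 * p) * (ln (c * t) * f t (real (Suc n)))) = (\<lambda>t. ln (c * t) * S n t)"
      unfolding S_def right_diff_distrib[symmetric] sum_distrib_left[symmetric]
      by (simp add: algebra_simps)
    \<comment> \<open>Within each summand \<open>ln c\<close> cancels, so the scale \<open>c\<close>
      survives only through the correction term.\<close>
    also have "(\<Sum>k<Suc n. pi / 2 * ln (c * (real k + p)) - pi / 2 * ln (c * (real k + 1 - p))) =
               (\<Sum>k<Suc n. pi / 2 * (ln (real k + p) - ln (real k + 1 - p)))"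
      using p by (intro sum.cong refl) (simp only: ln_c add_nonneg_pos of_nat_0_le_iff diff_gt_0_iff_gt
        add_diff_eq[symmetric], simp add: algebra_simps)
    also have "\<dots> + (1 - 2 * p) * (pi / 2 * ln (c * real (Suc n))) =
       pi / 2 * (((\<Sum>k<Suc n. ln (real k + p) - ln (real k + 1 - p)) + (1 - 2 * p) * ln (real (Suc n)))
                 + (1 - 2 * p) * ln c)"
      unfolding sum_distrib_left[symmetric]
      by (subst ln_c) (auto simp only: algebra_simps of_nat_0_less_iff zero_less_Suc)
    finally show ?thesis .
  qed

  have h: "h integrable_on {0<..}"
    unfolding h_def using absolutely_integrable_ln_poisson_kernel(1)[of 1 c] c
    by (intro has_integral_integrable[OF has_integral_mult_right[OF integrable_integral]])
       (simp add: absolutely_integrable_on_def)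
  have le_h: "norm (ln (c * t) * S n t) \<le> h t" for n t
    using mult_left_mono[OF S_bound[of n t], of "\<bar>ln (c * t)\<bar>"]
    by (simp add: h_def abs_mult mult_ac)
  have lim: "(\<lambda>n. ln (c * t) * S n t) \<longlonglongrightarrow> g t" for t
    unfolding g_def by (intro tendsto_intros S_lim)
  have g: "(g has_integral pi / 2 * (ln (Gamma (1 - p)) - ln (Gamma p) + (1 - 2 * p) * ln c)) {0<..}"
    using int_S h
  proof (rule has_integral_dominated_convergence)
    show "(\<lambda>n. pi / 2 * (((\<Sum>k<Suc n. ln (real k + p) - ln (real k + 1 - p)) + (1 - 2 * p) * ln (real (Suc n)))
                      + (1 - 2 * p) * ln c))
            \<longlonglongrightarrow> pi / 2 * (ln (Gamma (1 - p)) - ln (Gamma p) + (1 - 2 * p) * ln c)"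
      by (intro tendsto_mult tendsto_add ln_Gamma_quotient_LIMSEQ p tendsto_const)
  qed (use le_h lim in auto)
  \<comment> \<open>The uniform majorant passes to the limit. It upgrades integrability to absolute
    integrability, as the later change of variables requires.\<close>
  have "norm (g t) \<le> h t" for t
    by (rule Lim_bounded[OF tendsto_norm[OF lim]]) (use le_h in auto)
  thus "g absolutely_integrable_on {0<..}"
    using g h by (intro absolutely_integrable_integrable_bound[of _ g h]) auto
  show "integral {0<..} g = pi / 2 * (ln (Gamma (1 - p)) - ln (Gamma p) + (1 - 2 * p) * ln c)"
    using g by (rule integral_unique)
qed

section \<open>Exponential substitution and evaluation at one sixth\<close>

theorem corollary3p4:
  "((\<lambda>x::real. ln (- ln x) * (1 / (1 - x + x\<^sup>2))) has_integral
     2 * pi / sqrt 3 * (5 / 6 * ln (2 * pi) - ln (Gamma (1 / 6 :: real)))) {0<..<1}"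
proof -
  define F where "F = (\<lambda>x::real. ln (- ln x) * (1 / (1 - x + x\<^sup>2)))"
  define g where "g = (\<lambda>t. ln (2 * pi * t) *
    (pi * sin (2 * pi * (1 / 6)) / (cosh (2 * pi * t) - cos (2 * pi * (1 / 6)))))"
  define I where "I = 2 * pi / sqrt 3 * (5 / 6 * ln (2 * pi) - ln (Gamma (1 / 6 :: real)))"
  have g: "g absolutely_integrable_on {0<..}"
    "integral {0<..} g = pi / 2 * (ln (Gamma (1 - 1 / 6)) - ln (Gamma (1 / 6)) + (1 - 2 * (1 / 6)) * ln (2 * pi))"
    unfolding g_def by (rule absolutely_integrable_ln_cosh_kernel; simp)+
  have "Gamma (1 / 6 :: real) * Gamma (1 - 1 / 6) = 2 * pi"
    using Gamma_reflection_real[of "1 / 6"] sin_30 by simp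
  moreover have "Gamma (1 / 6 :: real) > 0" "Gamma (1 - 1 / 6 :: real) > 0"
    by (simp_all add: Gamma_real_pos)
  ultimately have "ln (Gamma (1 - 1 / 6)) = ln (2 * pi) - ln (Gamma (1 / 6 :: real))"
    by (metis add_diff_cancel_left' ln_mult_pos)
  \<comment> \<open>The coefficient \<open>5 / 6\<close> is half of \<open>1 + 2 / 3\<close>: 1 from
    eliminating \<open>Gamma (5 / 6)\<close>, \<open>2 / 3\<close> from
    \<open>1 - 2 * p\<close>.\<close>
  hence I: "2 / sqrt 3 * integral {0<..} g = I"
    unfolding g I_def by (simp only:) (simp add: field_simps)

  \<comment> \<open>Proved for every real \<open>t\<close>, so that it can rewrite the integrand
    under the abstraction.\<close>
  have subst: "\<bar>- (2 * pi * exp (- (2 * pi * t)))\<bar> * F (exp (- (2 * pi * t))) = 2 / sqrt 3 * g t" for t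
  proof -
    define E where "E = exp (2 * pi * t)"
    have E: "E > 0" "exp (- (2 * pi * t)) = 1 / E"
      by (simp_all add: E_def exp_minus field_simps)
    have mult: "(1 - 1 / E + (1 / E)\<^sup>2) * E\<^sup>2 = E\<^sup>2 - E + 1"
      using E by (simp add: field_simps power2_eq_square)
    have "1 - 1 / E + (1 / E)\<^sup>2 = (E\<^sup>2 - E + 1) / E\<^sup>2"
      unfolding mult[symmetric] using E by simp
    hence "2 * pi / E * (1 / (1 - 1 / E + (1 / E)\<^sup>2)) = 2 * pi * E / (E\<^sup>2 - E + 1)"
      using E by (simp add: power2_eq_square)
    \<comment> \<open>The constant \<open>1 / 2\<close> is \<open>cos (pi / 3)\<close>, which forces
      \<open>p = 1 / 6\<close>; the factor \<open>2 / sqrt 3\<close> then compensates for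
      \<open>sin (pi / 3)\<close>.\<close>
    also have "E\<^sup>2 - E + 1 = 2 * E * (cosh (2 * pi * t) - 1 / 2)"
      using E unfolding cosh_def E_def[symmetric] by (simp add: field_simps power2_eq_square)
    also have "2 * pi * E / \<dots> = 2 / sqrt 3 * (pi * (sqrt 3 / 2) / (cosh (2 * pi * t) - 1 / 2))"
    proof -
      have "2 * pi * E / (2 * E * x) = 2 / sqrt 3 * (pi * (sqrt 3 / 2) / x)" for x
        using E by simp
      thus ?thesis .
    qed
    also have "\<dots> = 2 / sqrt 3 * (pi * sin (2 * pi * (1 / 6)) / (cosh (2 * pi * t) - cos (2 * pi * (1 / 6))))"
      by (simp add: sin_60 cos_60)
    finally have kernel: "2 * pi / E * (1 / (1 - 1 / E + (1 / E)\<^sup>2)) = \<dots>" .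
    have "\<bar>- (2 * pi * exp (- (2 * pi * t)))\<bar> * F (exp (- (2 * pi * t))) =
            ln (2 * pi * t) * (2 * pi / E * (1 / (1 - 1 / E + (1 / E)\<^sup>2)))"
      unfolding F_def ln_exp using E by (simp add: abs_mult)
    thus ?thesis
      unfolding kernel g_def by (simp only: mult.left_commute)
  qed
  have "(\<lambda>t. exp (- (2 * pi * t))) ` {0<..} = {0<..<1}"
  proof
    show "{0<..<1} \<subseteq> (\<lambda>t. exp (- (2 * pi * t))) ` {0<..}"
    proof
      fix x :: real assume "x \<in> {0<..<1}"
      thus "x \<in> (\<lambda>t. exp (- (2 * pi * t))) ` {0<..}"
        by (intro image_eqI[of _ _ "- ln x / (2 * pi)"]) (auto simp: divide_simps)
    qed
  qed auto
  moreover have "(\<lambda>t. \<bar>- (2 * pi * exp (- (2 * pi * t)))\<bar> * F (exp (- (2 * pi * t)))) absolutely_integrable_on {0<..} \<and>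
    integral {0<..} (\<lambda>t. \<bar>- (2 * pi * exp (- (2 * pi * t)))\<bar> * F (exp (- (2 * pi * t)))) = I"
    unfolding subst using g(1) I by simp
  \<comment> \<open>The change of variables is an equivalence, here read from the half-line back to
    the unit interval. The absolute value of the derivative accounts for the reversed
    orientation.\<close>
  ultimately have "F absolutely_integrable_on {0<..<1} \<and> integral {0<..<1} F = I"
    by (subst (asm) has_absolute_integral_change_of_variables_1')
       (auto intro!: derivative_eq_intros simp: inj_on_def)
  hence "(F has_integral I) {0<..<1}"
    by (metis has_integral_integrable_integral set_lebesgue_integral_eq_integral(1))
  thus ?thesis
    unfolding F_def I_def .
qed

end
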